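(* Let $\mathbb{K}$ be an algebraically closed field of characteristic zero. Every 3-dimensional ternary Nambu-Lie algebra over $\mathbb{K}$ is isomorphic to the ternary algebra $A$ with basis $\{e_1,e_2,e_3\}$ whose skew-symmetric bracket is defined by $$\{e_1,e_2,e_3\}=e_1.$$ Moreover, it defines a 3-dimensional non-commutative ternary Nambu-Poisson algebra $(A,\mu,\{\cdot,\cdot,\cdot\})$ if and only if $\mu$ is one of the following non-commutative associative multiplications (products of basis elements not listed are zero): (1) $\mu_1(e_2,e_1)=a e_1$, $\mu_1(e_2,e_2)=a e_2$, $\mu_1(e_2,e_3)=a e_3$, $\mu_1(e_3,e_1)=b e_1$, $\mu_1(e_3,e_2)=b e_2$, $\mu_1(e_3,e_3)=b e_3$, where $a,b$ are parameters; (2) $\mu_2(e_1,e_2)=a e_1$, $\mu_2(e_1,e_3)=b e_1$, $\mu_2(e_2,e_2)=a e_2$, $\mu_2(e_2,e_3)=b e_2$, $\mu_2(e_3,e_2)=a e_3$, $\mu_2(e_3,e_3)=b e_3$, where $a,b$ are parameters with $a\neq 0$; (3) $\mu_3(e_1,e_3)=a e_1$, $\mu_3(e_2,e_3)=a e_2$, $\mu_3(e_3,e_3)=a e_3$, where $a$ is a parameter with $a\neq 0$.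
   Context: All vector spaces are over $\mathbb{K}$ and the parameters $a,b$ lie in $\mathbb{K}$. A ternary Nambu-Lie algebra is a vector space $A$ with a trilinear bracket $\{\cdot,\cdot,\cdot\}:A\times A\times A\to A$ that is skew-symmetric ($\{x_{\sigma(1)},x_{\sigma(2)},x_{\sigma(3)}\}=\mathrm{sgn}(\sigma)\{x_1,x_2,x_3\}$ for all $\sigma\in S_3$) and satisfies the fundamental identity $\{x_1,x_2,\{x_3,x_4,x_5\}\}=\{\{x_1,x_2,x_3\},x_4,x_5\}+\{x_3,\{x_1,x_2,x_4\},x_5\}+\{x_3,x_4,\{x_1,x_2,x_5\}\}$ for all elements of $A$. Isomorphisms are bijective linear maps preserving the bracket. A non-commutative ternary Nambu-Poisson algebra $(A,\mu,\{\cdot,\cdot,\cdot\})$ is a ternary Nambu-Lie algebra $(A,\{\cdot,\cdot,\cdot\})$ with a bilinear map $\mu:A\times A\to A$ such that $(A,\mu)$ is associative and the Leibniz rule $\{x_1,x_2,\mu(x_3,x_4)\}=\mu(x_3,\{x_1,x_2,x_4\})+\mu(\{x_1,x_2,x_3\},x_4)$ holds for all elements of $A$. Here $\mu$ is not assumed to be commutative.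
   Formalization: The bracket of the 3-dimensional algebra is assumed not identically zero (the zero bracket is a counterexample); μ_1 is claimed to be non-commutative only for (a,b) ≠ (0,0), since for a=b=0 it is the zero product, which remains in the list. *)

theory Defs
  imports "HOL-Analysis.Analysis" "HOL-Combinatorics.Permutations"
    "HOL-Computational_Algebra.Polynomial"
begin

locale ternary_nambu_lie = vector_space scale
  for scale :: "'k::field \<Rightarrow> 'v::ab_group_add \<Rightarrow> 'v" +
  fixes br :: "'v \<Rightarrow> 'v \<Rightarrow> 'v \<Rightarrow> 'v"
  assumes linear_1: "Vector_Spaces.linear scale scale (\<lambda>x. br x y z)"
    and linear_2: "Vector_Spaces.linear scale scale (\<lambda>y. br x y z)"
    and linear_3: "Vector_Spaces.linear scale scale (\<lambda>z. br x y z)"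
    and skew_symmetric: "\<sigma> permutes {1, 2, 3::nat} \<Longrightarrow>
      br (u (\<sigma> 1)) (u (\<sigma> 2)) (u (\<sigma> 3)) = scale (of_int (sign \<sigma>)) (br (u 1) (u 2) (u 3))"
    and fundamental_identity:
      "br x1 x2 (br x3 x4 x5) =
        br (br x1 x2 x3) x4 x5 + br x3 (br x1 x2 x4) x5 + br x3 x4 (br x1 x2 x5)"

(* "Non-commutative" means that commutativity of mu is not required. *)
locale nc_ternary_nambu_poisson = ternary_nambu_lie scale br
  for scale :: "'k::field \<Rightarrow> 'v::ab_group_add \<Rightarrow> 'v"
    and mu :: "'v \<Rightarrow> 'v \<Rightarrow> 'v"
    and br :: "'v \<Rightarrow> 'v \<Rightarrow> 'v \<Rightarrow> 'v" +
  assumes mu_linear_1: "Vector_Spaces.linear scale scale (\<lambda>x. mu x y)"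
    and mu_linear_2: "Vector_Spaces.linear scale scale (\<lambda>y. mu x y)"
    and mu_assoc: "mu (mu x y) z = mu x (mu y z)"
    and leibniz: "br x1 x2 (mu x3 x4) = mu x3 (br x1 x2 x4) + mu (br x1 x2 x3) x4"

definition ternary_isomorphic ::
  "('k::field \<Rightarrow> 'v::ab_group_add \<Rightarrow> 'v) \<Rightarrow> ('v \<Rightarrow> 'v \<Rightarrow> 'v \<Rightarrow> 'v) \<Rightarrow>
   ('k \<Rightarrow> 'w::ab_group_add \<Rightarrow> 'w) \<Rightarrow> ('w \<Rightarrow> 'w \<Rightarrow> 'w \<Rightarrow> 'w) \<Rightarrow> bool" where
  "ternary_isomorphic s1 br1 s2 br2 \<longleftrightarrow>
    (\<exists>f. Vector_Spaces.linear s1 s2 f \<and> bij f \<and>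
      (\<forall>x y z. f (br1 x y z) = br2 (f x) (f y) (f z)))"

(* The underlying space of A is 'k ^ 3 with its standard basis. The index type 3 has the
   elements 1, 2, 3 (with 3 = 0), so e 1, e 2, e 3 are the three basis vectors. *)
abbreviation e :: "3 \<Rightarrow> 'k::field ^ 3" where
  "e i \<equiv> axis i 1"

definition bilinear_extension ::
  "(3 \<Rightarrow> 3 \<Rightarrow> 'k::field ^ 3) \<Rightarrow> 'k ^ 3 \<Rightarrow> 'k ^ 3 \<Rightarrow> 'k ^ 3" where
  "bilinear_extension t x y = (\<Sum>i\<in>UNIV. \<Sum>j\<in>UNIV. (x $ i * y $ j) *s t i j)"

definition trilinear_extension ::
  "(3 \<Rightarrow> 3 \<Rightarrow> 3 \<Rightarrow> 'k::field ^ 3) \<Rightarrow> 'k ^ 3 \<Rightarrow> 'k ^ 3 \<Rightarrow> 'k ^ 3 \<Rightarrow> 'k ^ 3" where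
  "trilinear_extension t x y z =
    (\<Sum>i\<in>UNIV. \<Sum>j\<in>UNIV. \<Sum>k\<in>UNIV. (x $ i * y $ j * z $ k) *s t i j k)"

definition brA :: "'k::field ^ 3 \<Rightarrow> 'k ^ 3 \<Rightarrow> 'k ^ 3 \<Rightarrow> 'k ^ 3" where
  "brA = trilinear_extension (\<lambda>i j k.
    if (i, j, k) \<in> {(1, 2, 3), (2, 3, 1), (3, 1, 2)} then e 1
    else if (i, j, k) \<in> {(2, 1, 3), (1, 3, 2), (3, 2, 1)} then - e 1
    else 0)"

definition mu1 :: "'k::field \<Rightarrow> 'k \<Rightarrow> 'k ^ 3 \<Rightarrow> 'k ^ 3 \<Rightarrow> 'k ^ 3" where
  "mu1 a b = bilinear_extension (\<lambda>i j.
    if (i, j) = (2, 1) then a *s e 1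
    else if (i, j) = (2, 2) then a *s e 2
    else if (i, j) = (2, 3) then a *s e 3
    else if (i, j) = (3, 1) then b *s e 1
    else if (i, j) = (3, 2) then b *s e 2
    else if (i, j) = (3, 3) then b *s e 3
    else 0)"

definition mu2 :: "'k::field \<Rightarrow> 'k \<Rightarrow> 'k ^ 3 \<Rightarrow> 'k ^ 3 \<Rightarrow> 'k ^ 3" where
  "mu2 a b = bilinear_extension (\<lambda>i j.
    if (i, j) = (1, 2) then a *s e 1
    else if (i, j) = (1, 3) then b *s e 1
    else if (i, j) = (2, 2) then a *s e 2
    else if (i, j) = (2, 3) then b *s e 2
    else if (i, j) = (3, 2) then a *s e 3
    else if (i, j) = (3, 3) then b *s e 3
    else 0)"

definition mu3 :: "'k::field \<Rightarrow> 'k ^ 3 \<Rightarrow> 'k ^ 3 \<Rightarrow> 'k ^ 3" where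
  "mu3 a = bilinear_extension (\<lambda>i j.
    if (i, j) = (1, 3) then a *s e 1
    else if (i, j) = (2, 3) then a *s e 2
    else if (i, j) = (3, 3) then a *s e 3
    else 0)"

definition noncommutative :: "('v \<Rightarrow> 'v \<Rightarrow> 'v) \<Rightarrow> bool" where
  "noncommutative mu \<longleftrightarrow> (\<exists>x y. mu x y \<noteq> mu y x)"

end

theory Submission
  imports Defs
begin

text \<open>An alternating trilinear map on a 3-dimensional space is a determinant times a fixed vector
  \<open>w\<close>; completing \<open>w\<close> to a basis and rescaling gives \<open>{e\<^sub>1, e\<^sub>2, e\<^sub>3} = e\<^sub>1\<close>.
  For this bracket the maps \<open>z \<mapsto> {x, y, z}\<close> are spanned by the \<open>z \<mapsto> z\<^sub>i e\<^sub>1\<close>, so the Leibniz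
  rule forces \<open>\<mu>(x, y) = r(x) y + l(y) x\<close> with linear forms \<open>r\<close>, \<open>l\<close> vanishing at \<open>e\<^sub>1\<close>, and
  associativity forces \<open>r = 0\<close> or \<open>l = 0\<close>.\<close>

section \<open>Alternating trilinear maps\<close>

text \<open>The transposition (1 3) is (1 2)(2 3)(1 2), so every transposition changes the sign; a
  permutation is then built up from transpositions. The family \<open>u\<close> is generalized in
  the induction because a new transposition is absorbed into it.\<close>

lemma skew_symmetric_if_swaps:
  fixes scale :: "'k::field \<Rightarrow> 'v::ab_group_add \<Rightarrow> 'v" and f :: "'a \<Rightarrow> 'a \<Rightarrow> 'a \<Rightarrow> 'v"
  assumes "vector_space scale"
    and swap12: "\<And>x y z. f y x z = - f x y z"
    and swap23: "\<And>x y z. f x z y = - f x y z"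
    and "\<sigma> permutes {1, 2, 3::nat}"
  shows "f (u (\<sigma> 1)) (u (\<sigma> 2)) (u (\<sigma> 3)) = scale (of_int (sign \<sigma>)) (f (u 1) (u 2) (u 3))"
proof -
  interpret vector_space scale by fact
  have swap13: "f z y x = - f x y z" for x y z
    using swap12[of y z x] swap23[of y x z] swap12[of x y z] by simp
  have transp: "f (u (Transposition.transpose a b 1)) (u (Transposition.transpose a b 2))
      (u (Transposition.transpose a b 3)) = - f (u 1) (u 2) (u 3)"
    if "a \<in> {1, 2, 3}" "b \<in> {1, 2, 3}" "a \<noteq> b" for a b :: nat and u
    using that swap12[of "u 1" "u 2" "u 3"] swap23[of "u 1" "u 2" "u 3"] swap13[of "u 1" "u 2" "u 3"]
    by (auto simp: transpose_def)
  have "finite {1, 2, 3::nat}"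
    by simp
  with \<open>\<sigma> permutes _\<close> show ?thesis
  proof (induction arbitrary: u rule: permutes_induct)
    case id
    then show ?case by simp
  next
    case (swap a b p)
    have "permutation p"
      unfolding permutation_permutes using \<open>p permutes _\<close> \<open>finite {1, 2, 3::nat}\<close> by blast
    then have "sign (Transposition.transpose a b \<circ> p) = - sign p"
      using \<open>a \<noteq> b\<close> by (simp add: sign_compose permutation_swap_id sign_swap_id)
    moreover note swap.IH[of "u \<circ> Transposition.transpose a b"]
    moreover note transp[OF swap.hyps(1-3), of u]
    ultimately show ?case
      by (simp only: o_def of_int_minus scale_minus_left scale_minus_right)
  qed
qed

context ternary_nambu_lie
begin

lemma br_add:
  "br (x + x') y z = br x y z + br x' y z"
  "br x (y + y') z = br x y z + br x y' z"
  "br x y (z + z') = br x y z + br x y z'"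
  using linear_1[of y z] linear_2[of x z] linear_3[of x y] by (simp_all add: Vector_Spaces.linear_iff)

lemma br_scale:
  "br (scale c x) y z = scale c (br x y z)"
  "br x (scale c y) z = scale c (br x y z)"
  "br x y (scale c z) = scale c (br x y z)"
  using linear_1[of y z] linear_2[of x z] linear_3[of x y] by (simp_all add: Vector_Spaces.linear_iff)

lemma br_swap:
  "br y x z = - br x y z"
  "br x z y = - br x y z"
proof -
  \<comment> \<open>The entry \<open>0\<close> only pads the list, so that \<open>x\<close>,
    \<open>y\<close>, \<open>z\<close> stand at the indices 1, 2, 3.\<close>
  have "br ([0,x,y,z] ! Transposition.transpose a b 1) ([0,x,y,z] ! Transposition.transpose a b 2)
      ([0,x,y,z] ! Transposition.transpose a b 3)
      = - br x y z" if "a \<in> {1, 2, 3}" "b \<in> {1, 2, 3}" "a \<noteq> b" for a b :: nat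
    using skew_symmetric[OF permutes_swap_id[OF that(1,2)], of "\<lambda>n. [0,x,y,z] ! n"] \<open>a \<noteq> b\<close>
    by (simp add: sign_swap_id)
  from this[of 1 2] this[of 2 3] show "br y x z = - br x y z" "br x z y = - br x y z"
    by (simp_all add: transpose_def)
qed

end

section \<open>The bracket and the products in coordinates\<close>

text \<open>The coefficient is the determinant of \<open>x\<close>, \<open>y\<close>,
  \<open>z\<close>, expanded along \<open>x\<close>.\<close>

lemma brA_eq:
  "brA x y z = (x$1 * (y$2 * z$3 - y$3 * z$2) + x$2 * (y$3 * z$1 - y$1 * z$3)
      + x$3 * (y$1 * z$2 - y$2 * z$1)) *s e 1"
  by (simp add: brA_def trilinear_extension_def sum_3 vec_eq_iff forall_3 axis_def algebra_simps)

text \<open>Each multiplication table collapses to a linear form in one factor times the other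
  factor: the left factor is evaluated for \<open>mu1\<close>, the right one for \<open>mu2\<close>
  and \<open>mu3\<close>.\<close>

lemma mu1_eq: "mu1 a b x y = (a * x$2 + b * x$3) *s y"
  by (simp add: mu1_def bilinear_extension_def sum_3 vec_eq_iff forall_3 axis_def algebra_simps)

lemma mu2_eq: "mu2 a b x y = (a * y$2 + b * y$3) *s x"
  by (simp add: mu2_def bilinear_extension_def sum_3 vec_eq_iff forall_3 axis_def algebra_simps)

lemma mu3_eq: "mu3 a x y = (a * y$3) *s x"
  by (simp add: mu3_def bilinear_extension_def sum_3 vec_eq_iff forall_3 axis_def algebra_simps)

lemma brA_linear:
  "Vector_Spaces.linear (*s) (*s) (\<lambda>x. brA x y z)"
  "Vector_Spaces.linear (*s) (*s) (\<lambda>y. brA x y z)"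
  "Vector_Spaces.linear (*s) (*s) (\<lambda>z. brA x y z)"
  unfolding Vector_Spaces.linear_iff
  by (simp_all add: vec.vector_space_axioms brA_eq vec_eq_iff axis_def algebra_simps)

text \<open>The map D = \<open>brA x1 x2\<close> has its image in the line of \<open>e 1\<close>, so
  D(\<open>e 1\<close>) = tr(D) \<open>e 1\<close>. The identity thus says that applying D to each
  argument of a determinant in turn and summing multiplies it by tr(D).\<close>

lemma brA_fundamental_identity:
  "brA x1 x2 (brA x3 x4 x5) =
    brA (brA x1 x2 x3) x4 x5 + brA x3 (brA x1 x2 x4) x5 + brA x3 x4 (brA x1 x2 x5)"
proof -
  have "brA x1 x2 (brA x3 x4 x5) $ 1 =
    (brA (brA x1 x2 x3) x4 x5 + brA x3 (brA x1 x2 x4) x5 + brA x3 x4 (brA x1 x2 x5)) $ 1"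
    by (simp add: brA_eq axis_def) algebra
  then show ?thesis
    by (simp add: brA_eq vec_eq_iff axis_def)
qed

lemma ternary_nambu_lie_brA: "ternary_nambu_lie (*s) (brA :: 'k::field ^ 3 \<Rightarrow> _)"
proof (intro ternary_nambu_lie.intro ternary_nambu_lie_axioms.intro vec.vector_space_axioms
    brA_linear brA_fundamental_identity)
  fix \<sigma> and u :: "nat \<Rightarrow> 'k ^ 3"
  assume \<sigma>: "\<sigma> permutes {1, 2, 3::nat}"
  have "brA y x z = - brA x y z" "brA x z y = - brA x y z" for x y z :: "'k ^ 3"
    by (simp_all add: brA_eq vec_eq_iff axis_def algebra_simps)
  from skew_symmetric_if_swaps[of "(*s)" brA, OF vec.vector_space_axioms this \<sigma>]
  show "brA (u (\<sigma> 1)) (u (\<sigma> 2)) (u (\<sigma> 3)) = of_int (sign \<sigma>) *s brA (u 1) (u 2) (u 3)"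
    .
qed

section \<open>Three-dimensional Nambu-Lie algebras\<close>

lemma (in vector_space) dim_3_basis:
  assumes "dim UNIV = 3" "w \<noteq> 0"
  obtains p q where "independent {w, p, q}" "span {w, p, q} = UNIV" "w \<noteq> p" "w \<noteq> q" "p \<noteq> q"
proof -
  define B where "B = extend_basis {w}"
  have "independent {w}"
    using \<open>w \<noteq> 0\<close> by simp
  then have B: "{w} \<subseteq> B" "independent B" "span B = UNIV"
    unfolding B_def by (fact extend_basis_superset independent_extend_basis span_extend_basis)+
  then have "card B = 3"
    using dim_eq_card[of B UNIV] assms(1) by simp
  with \<open>{w} \<subseteq> B\<close> have "card (B - {w}) = 2"
    by simp
  then obtain p q where "B - {w} = {p, q}" "p \<noteq> q"
    by (auto simp: card_2_iff)
  moreover from this \<open>{w} \<subseteq> B\<close> have "B = {w, p, q}"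
    by auto
  ultimately show thesis
    using that[of p q] B by auto
qed

text \<open>The factor \<open>c\<close> leaves room for rescaling the second basis vector when the
  bracket is normalized.\<close>

lemma (in vector_space) bij_coordinates_3:
  assumes "independent {w, p, q}" "span {w, p, q} = UNIV" "w \<noteq> p" "w \<noteq> q" "p \<noteq> q" "c \<noteq> 0"
  shows "bij (\<lambda>v :: 'a ^ 3. scale (v$1) w + scale (v$2 * c) p + scale (v$3) q)" (is "bij ?g")
proof (rule bijI)
  show "inj ?g"
  proof (rule injI)
    fix u v assume "?g u = ?g v"
    \<comment> \<open>Independence is stated for coefficients indexed by the basis vectors
      themselves, so the coordinate differences are repackaged that way.\<close>
    define d where "d b = (if b = w then u$1 - v$1 else if b = p then (u$2 - v$2) * c else u$3 - v$3)" for b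
    have "(\<Sum>b\<in>{w, p, q}. scale (d b) b) = ?g u - ?g v"
      using assms(3-5) by (simp add: d_def scale_left_diff_distrib left_diff_distrib)
    also have "\<dots> = 0"
      using \<open>?g u = ?g v\<close> by simp
    finally have "d b = 0" if "b \<in> {w, p, q}" for b
      using independentD[OF assms(1) _ subset_refl] that by blast
    from this[of w] this[of p] this[of q] show "u = v"
      using assms(3-6) by (simp add: d_def vec_eq_iff forall_3)
  qed
  show "surj ?g"
  proof (rule surjI[of _ "\<lambda>x. vector [representation {w, p, q} x w, representation {w, p, q} x p / c,
      representation {w, p, q} x q]"])
    fix x
    show "?g (vector [representation {w, p, q} x w, representation {w, p, q} x p / c,
      representation {w, p, q} x q]) = x"
      using sum_representation_eq[OF assms(1), of x "{w, p, q}"] assms(2-6) by (simp add: add.assoc)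
  qed
qed

context ternary_nambu_lie
begin

lemma br_repeated:
  assumes "(2::'k) \<noteq> 0"
  shows "br x x y = 0" "br x y y = 0" "br x y x = 0"
proof -
  have zero: "v = 0" if "v = - v" for v :: 'v
  proof -
    have "scale 2 v = v + v"
      using scale_left_distrib[of 1 1 v] by simp
    also have "\<dots> = 0"
      by (metis that add.right_inverse)
    finally show ?thesis
      using assms by simp
  qed
  show *: "br x x y = 0" "br x y y = 0" for x y
    by (rule zero, rule br_swap)+
  show "br x y x = 0"
    using br_swap(2)[of x x y] by (simp add: *)
qed

text \<open>After trilinear expansion the terms with a repeated vector vanish and the other six are
  signed copies of \<open>br w p q\<close>. The first coordinate of \<open>brA\<close> serves as the
  determinant.\<close>

lemma br_combination:
  fixes u v t :: "'k ^ 3" and w p q :: 'v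
  assumes "(2::'k) \<noteq> 0"
  defines "g \<equiv> \<lambda>v. scale (v$1) w + scale (v$2) p + scale (v$3) q"
  shows "br (g u) (g v) (g t) = scale (brA u v t $ 1) (br w p q)"
proof -
  have "br w q p = - br w p q" "br p w q = - br w p q" "br q p w = - br w p q"
    "br p q w = br w p q" "br q w p = br w p q"
    by (metis br_swap minus_minus)+
  then show ?thesis
    by (simp add: g_def brA_eq axis_def br_add br_scale br_repeated[OF assms(1)] algebra_simps)
qed

lemma isomorphic_brA:
  assumes "(2::'k) \<noteq> 0" and "dim UNIV = 3" and "br x y z \<noteq> 0"
  shows "ternary_isomorphic scale br (*s) brA"
proof -
  define w where "w = br x y z"
  obtain p q where basis: "independent {w, p, q}" "span {w, p, q} = UNIV" "w \<noteq> p" "w \<noteq> q" "p \<noteq> q"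
    using dim_3_basis[OF assms(2)] assms(3) unfolding w_def by blast
  have "bij (\<lambda>v :: 'k ^ 3. scale (v$1) w + scale (v$2) p + scale (v$3) q)"
    using bij_coordinates_3[OF basis, of 1] by simp
  then obtain x' y' z' :: "'k ^ 3" where
    "br x y z = br (scale (x'$1) w + scale (x'$2) p + scale (x'$3) q)
       (scale (y'$1) w + scale (y'$2) p + scale (y'$3) q)
       (scale (z'$1) w + scale (z'$2) p + scale (z'$3) q)"
    by (metis (no_types, lifting) bij_pointE)
  \<comment> \<open>Here \<open>?c\<close> is the determinant of the coordinates of the arguments
    that produced \<open>w\<close>. Hence \<open>br w (scale ?c p) q = w\<close>, the defining
    relation of \<open>brA\<close> with \<open>w\<close> in the role of \<open>e 1\<close>.\<close>
  then have w: "w = scale (brA x' y' z' $ 1) (br w p q)" (is "_ = scale ?c _")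
    using br_combination[OF assms(1)] w_def by simp
  then have "?c \<noteq> 0"
    using assms(3) w_def by auto
  define g :: "'k ^ 3 \<Rightarrow> 'v" where "g v = scale (v$1) w + scale (v$2 * ?c) p + scale (v$3) q" for v
  have "bij g"
    unfolding g_def using bij_coordinates_3[OF basis \<open>?c \<noteq> 0\<close>] .
  have add: "g (u + v) = g u + g v" and scale: "g (c *s u) = scale c (g u)" for c u v
    by (simp_all add: g_def algebra_simps)
  have "br (g u) (g v) (g t) = scale (brA u v t $ 1) w" for u v t
    using br_combination[OF assms(1), of u w "scale ?c p" q v t] w by (simp add: g_def br_scale)
  then have br: "br (g u) (g v) (g t) = g (brA u v t)" for u v t
    by (simp add: g_def brA_eq axis_def)
  \<comment> \<open>\<open>g\<close> runs from the model to the given algebra, so the required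
    isomorphism is its inverse.\<close>
  have "Vector_Spaces.linear scale (*s) (inv g)"
    unfolding Vector_Spaces.linear_iff using vector_space_axioms vec.vector_space_axioms \<open>bij g\<close>
    by (metis (no_types, opaque_lifting) add scale bij_inv_eq_iff)
  moreover have "inv g (br x y z) = brA (inv g x) (inv g y) (inv g z)" for x y z
    using \<open>bij g\<close> by (metis br bij_inv_eq_iff)
  ultimately show ?thesis
    unfolding ternary_isomorphic_def using \<open>bij g\<close> bij_imp_bij_inv by blast
qed

end

section \<open>Compatible associative products\<close>

lemma nambu_poisson_brA_cases:
  fixes mu :: "'k::field ^ 3 \<Rightarrow> 'k ^ 3 \<Rightarrow> 'k ^ 3"
  assumes "nc_ternary_nambu_poisson (*s) mu brA"
  shows "(\<exists>a b. mu = mu1 a b) \<or> (\<exists>a b. mu = mu2 a b)"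
proof -
  interpret nc_ternary_nambu_poisson "(*s)" mu brA by fact
  define r where "r x = mu x (e 1) $ 1" for x
  define l where "l y = mu (e 1) y $ 1" for y
  have mu_linear:
    "mu (x + x') y = mu x y + mu x' y" "mu (c *s x) y = c *s mu x y"
    "mu x (y + y') = mu x y + mu x y'" "mu x (c *s y) = c *s mu x y" for x x' y y' c
    using mu_linear_1[of y] mu_linear_2[of x] by (simp_all add: Vector_Spaces.linear_iff)
  have r_linear: "r (x + y) = r x + r y" "r (c *s x) = c * r x"
    and l_linear: "l (x + y) = l x + l y" "l (c *s x) = c * l x" for x y c
    by (simp_all add: r_def l_def mu_linear)
  have e_decomp: "x = x$1 *s e 1 + x$2 *s e 2 + x$3 *s e 3" for x :: "'k ^ 3"
    by (simp add: vec_eq_iff forall_3 axis_def)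
  \<comment> \<open>Bracketing with two basis vectors in cyclic order extracts one coordinate, as a
    multiple of \<open>e 1\<close>; this is the Leibniz rule for these three pairs.\<close>
  have leibniz_coord: "mu x y $ i *s e 1 = y $ i *s mu x (e 1) + x $ i *s mu (e 1) y" for x y i
  proof -
    have "brA (e 2) (e 3) z = z$1 *s e 1" "brA (e 3) (e 1) z = z$2 *s e 1"
      "brA (e 1) (e 2) z = z$3 *s e 1" for z :: "'k ^ 3"
      by (simp_all add: brA_eq axis_def)
    from leibniz[of "e 2" "e 3" x y, unfolded this] leibniz[of "e 3" "e 1" x y, unfolded this]
      leibniz[of "e 1" "e 2" x y, unfolded this]
    show ?thesis
      using exhaust_3[of i] by (elim disjE) (simp_all only: mu_linear)
  qed
  have off_line: "mu x (e 1) $ j = 0" "mu (e 1) x $ j = 0" if "j \<noteq> 1" for x j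
  proof -
    have *: "y $ i * mu x (e 1) $ j + x $ i * mu (e 1) y $ j = 0" for x y i
      using arg_cong[OF leibniz_coord[of x y i], of "\<lambda>v. v $ j"] that by (simp add: axis_def)
    \<comment> \<open>In both claims the second instance of \<open>*\<close> removes the mixed term,
      in \<open>mu (e 1) (e 2)\<close> or \<open>mu (e 2) (e 1)\<close>, left over by the
      first.\<close>
    show "mu x (e 1) $ j = 0"
      using *[of "e 2" 2 x] *[of "e 2" 1 "e 1"] by (simp add: axis_def)
    show "mu (e 1) x $ j = 0"
      using *[of x 2 "e 2"] *[of "e 1" 1 "e 2"] by (simp add: axis_def)
  qed
  have coord: "mu x y $ i = r x * y $ i + l y * x $ i" for x y i
    using arg_cong[OF leibniz_coord[of x y i], of "\<lambda>v. v $ 1"]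
    by (simp add: r_def l_def axis_def algebra_simps)
  then have mu: "mu x y = r x *s y + l y *s x" for x y
    by (simp add: vec_eq_iff)
  \<comment> \<open>These are the second coordinates of \<open>mu (e 1) (e 2)\<close> and
    \<open>mu (e 2) (e 1)\<close>.\<close>
  have "r (e 1) = 0" "l (e 1) = 0"
    using off_line[of 2 "e 2"] by (simp_all add: coord axis_def)
  \<comment> \<open>Associativity on \<open>x\<close>, \<open>y\<close>, \<open>e 1\<close> makes
    \<open>r\<close> multiplicative, whereas linearity applied to the formula for
    \<open>mu x y\<close> yields the extra term \<open>l y * r x\<close>.\<close>
  have "l y * r x = 0" for x y
  proof -
    have "mu v (e 1) = r v *s e 1" for v
      using mu[of v "e 1"] \<open>l (e 1) = 0\<close> by simp
    then have "r (mu x y) *s e 1 = (r x * r y) *s (e 1 :: 'k ^ 3)"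
      using mu_assoc[of x y "e 1"] by (simp add: mu_linear)
    then have "(r (mu x y) *s (e 1 :: 'k ^ 3)) $ 1 = ((r x * r y) *s (e 1 :: 'k ^ 3)) $ 1"
      by (rule arg_cong)
    then have "r (mu x y) = r x * r y"
      by (simp add: axis_def)
    moreover have "r (mu x y) = r x * r y + l y * r x"
      by (simp add: mu r_linear)
    ultimately show ?thesis
      by simp
  qed
  then consider "\<forall>x. r x = 0" | "\<forall>x. l x = 0"
    by (cases "\<forall>x. r x = 0") auto
  then show ?thesis
  proof cases
    case 1
    have l_eq: "l y = l (e 2) * y$2 + l (e 3) * y$3" for y
      using arg_cong[OF e_decomp, of l y] \<open>l (e 1) = 0\<close> by (simp add: l_linear mult.commute)
    have "mu x y = mu2 (l (e 2)) (l (e 3)) x y" for x y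
      using 1 l_eq[of y] by (simp add: mu mu2_eq)
    then show ?thesis
      by (metis ext)
  next
    case 2
    have r_eq: "r x = r (e 2) * x$2 + r (e 3) * x$3" for x
      using arg_cong[OF e_decomp, of r x] \<open>r (e 1) = 0\<close> by (simp add: r_linear mult.commute)
    have "mu x y = mu1 (r (e 2)) (r (e 3)) x y" for x y
      using 2 r_eq[of x] by (simp add: mu mu1_eq)
    then show ?thesis
      by (metis ext)
  qed
qed

text \<open>The form in \<open>mu1_eq\<close> vanishes at \<open>e 1\<close>, hence on all brackets,
  so one Leibniz term drops out; the other two agree by linearity. The same holds for
  \<open>mu2\<close> with the factors exchanged.\<close>

lemma nambu_poisson_brA_mu1: "nc_ternary_nambu_poisson (*s) (mu1 a b) brA"
  by (intro nc_ternary_nambu_poisson.intro nc_ternary_nambu_poisson_axioms.intro ternary_nambu_lie_brA)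
    (auto simp: Vector_Spaces.linear_iff vec.vector_space_axioms mu1_eq brA_eq vec_eq_iff axis_def algebra_simps)

lemma nambu_poisson_brA_mu2: "nc_ternary_nambu_poisson (*s) (mu2 a b) brA"
  by (intro nc_ternary_nambu_poisson.intro nc_ternary_nambu_poisson_axioms.intro ternary_nambu_lie_brA)
    (auto simp: Vector_Spaces.linear_iff vec.vector_space_axioms mu2_eq brA_eq vec_eq_iff axis_def algebra_simps)

text \<open>With \<open>mu2_0_0\<close> this sorts the products \<open>mu2 0 b\<close>: they form
  the third family, except that the zero product is counted under \<open>mu1\<close>.\<close>

lemma mu2_0_eq_mu3: "mu2 0 b = mu3 b"
  by (simp add: fun_eq_iff mu2_eq mu3_eq)

lemma mu2_0_0: "mu2 0 0 = mu1 0 0"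
  by (simp add: fun_eq_iff mu1_eq mu2_eq)

lemma nambu_poisson_brA_iff:
  "nc_ternary_nambu_poisson (*s) mu brA \<longleftrightarrow>
    (\<exists>a b. mu = mu1 a b) \<or> (\<exists>a b. a \<noteq> 0 \<and> mu = mu2 a b) \<or> (\<exists>a. a \<noteq> 0 \<and> mu = mu3 a)"
  by (metis nambu_poisson_brA_cases nambu_poisson_brA_mu1 nambu_poisson_brA_mu2 mu2_0_eq_mu3 mu2_0_0)

lemma noncommutative_mu1:
  assumes "(a, b) \<noteq> (0, 0)"
  shows "noncommutative (mu1 a b)"
proof -
  have "mu1 a b (e 2) (e 1) $ 1 = a" "mu1 a b (e 1) (e 2) $ 1 = 0"
    "mu1 a b (e 3) (e 1) $ 1 = b" "mu1 a b (e 1) (e 3) $ 1 = 0"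
    by (simp_all add: mu1_eq axis_def)
  then show ?thesis
    unfolding noncommutative_def using assms by metis
qed

lemma noncommutative_mu2:
  assumes "(a, b) \<noteq> (0, 0)"
  shows "noncommutative (mu2 a b)"
proof -
  have "mu2 a b (e 1) (e 2) $ 1 = a" "mu2 a b (e 2) (e 1) $ 1 = 0"
    "mu2 a b (e 1) (e 3) $ 1 = b" "mu2 a b (e 3) (e 1) $ 1 = 0"
    by (simp_all add: mu2_eq axis_def)
  then show ?thesis
    unfolding noncommutative_def using assms by metis
qed

text \<open>The zero bracket is a Nambu-Lie bracket not isomorphic to \<open>brA\<close>, so the
  first claim excludes it; likewise \<open>mu1 0 0\<close> is the zero product, which is
  commutative.\<close>

theorem theorem5p1:
  shows "(\<forall>(scale :: 'k::{alg_closed_field, field_char_0} \<Rightarrow> 'v::ab_group_add \<Rightarrow> 'v) br.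
            ternary_nambu_lie scale br \<and> vector_space.dim scale UNIV = 3 \<and>
            (\<exists>x y z. br x y z \<noteq> 0) \<longrightarrow>
            ternary_isomorphic scale br ((*s) :: 'k \<Rightarrow> 'k ^ 3 \<Rightarrow> 'k ^ 3) brA)
    \<and> (\<forall>mu :: 'k ^ 3 \<Rightarrow> 'k ^ 3 \<Rightarrow> 'k ^ 3.
            nc_ternary_nambu_poisson (*s) mu brA \<longleftrightarrow>
            (\<exists>a b. mu = mu1 a b) \<or>
            (\<exists>a b. a \<noteq> 0 \<and> mu = mu2 a b) \<or>
            (\<exists>a. a \<noteq> 0 \<and> mu = mu3 a))
    \<and> (\<forall>a b :: 'k. (a, b) \<noteq> (0, 0) \<longrightarrow> noncommutative (mu1 a b))
    \<and> (\<forall>a b :: 'k. a \<noteq> 0 \<longrightarrow> noncommutative (mu2 a b))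
    \<and> (\<forall>a :: 'k. a \<noteq> 0 \<longrightarrow> noncommutative (mu3 a))"
proof (intro conjI allI impI)
  fix scale :: "'k \<Rightarrow> 'v \<Rightarrow> 'v" and br
  assume A: "ternary_nambu_lie scale br \<and> vector_space.dim scale UNIV = 3 \<and> (\<exists>x y z. br x y z \<noteq> 0)"
  then interpret ternary_nambu_lie scale br by simp
  show "ternary_isomorphic scale br ((*s) :: 'k \<Rightarrow> 'k ^ 3 \<Rightarrow> 'k ^ 3) brA"
    using A isomorphic_brA by auto
next
  fix mu :: "'k ^ 3 \<Rightarrow> 'k ^ 3 \<Rightarrow> 'k ^ 3"
  show "nc_ternary_nambu_poisson (*s) mu brA \<longleftrightarrow>
      (\<exists>a b. mu = mu1 a b) \<or> (\<exists>a b. a \<noteq> 0 \<and> mu = mu2 a b) \<or> (\<exists>a. a \<noteq> 0 \<and> mu = mu3 a)"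
    by (rule nambu_poisson_brA_iff)
next
  fix a b :: 'k
  show "noncommutative (mu1 a b)" if "(a, b) \<noteq> (0, 0)"
    using noncommutative_mu1 that .
  show "noncommutative (mu2 a b)" if "a \<noteq> 0"
    using noncommutative_mu2[of a b] that by simp
  show "noncommutative (mu3 a)" if "a \<noteq> 0"
    using noncommutative_mu2[of 0 a] that by (simp add: mu2_0_eq_mu3)
qed

end
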